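(* Let $p \geq 1$ be fixed. Let $(b_n)_{n \geq 1}$ be a non-negative sequence of real numbers and let $(\lambda_n)_{n \geq 1}$ be a non-negative, non-increasing sequence of real numbers with $\lambda_1 > 0$. Let $\Lambda_n = \sum_{k=1}^n \lambda_k$. Then there is a constant $U_p > 0$ such that $$\sum_{n=1}^{\infty} b_n \left( \sum_{k=1}^{n} \frac{\lambda_k x_k}{\Lambda_n} \right)^p \leq U_p \sum_{n=1}^{\infty} b_n x_n^p \qquad (A)$$ holds for all non-negative, non-increasing sequences $(x_n)_{n \geq 1}$ if and only if there is a constant $U'_p > 0$ such that for all $n \geq 1$, $$\sum_{k=n}^{\infty} \frac{b_k}{\Lambda_k^p} \leq \frac{U'_p}{\Lambda_n^p} \sum_{k=1}^{n} b_k. \qquad (B)$$ Moreover, if $U_p$ and $U'_p$ are chosen best-possible in (A) and (B) respectively, then $$U'_p \leq U_p \leq \begin{cases} (pU'_p + 1)^p, & 1 \leq p \leq 2; \\ p^p (U'_p + 1)^p, & p > 2. \end{cases}$$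
   Context: All sequences are real. Infinite sums of non-negative terms are taken in $[0,\infty]$; inequality (A) is understood to hold trivially if its right-hand side is infinite. "Best-possible" means the constant is taken as small as possible, i.e. $U_p$ is the infimum of the constants for which (A) holds for all non-negative, non-increasing sequences $(x_n)_{n\ge 1}$, and $U'_p$ is the infimum of the constants for which (B) holds for all $n \geq 1$. *)

theory Defs
  imports "HOL-Analysis.Analysis"
begin

(* A sequence indexed by n >= 1 is a function on nat whose value at 0 is never used.
   Infinite sums of non-negative terms are taken in ennreal, i.e. in [0, infinity]. *)

definition partial_sum :: "(nat \<Rightarrow> real) \<Rightarrow> nat \<Rightarrow> real" where
  "partial_sum l n = (\<Sum>k=1..n. l k)"

definition nonneg_seq :: "(nat \<Rightarrow> real) \<Rightarrow> bool" where
  "nonneg_seq x \<longleftrightarrow> (\<forall>n\<ge>1. 0 \<le> x n)"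

definition nonincreasing_seq :: "(nat \<Rightarrow> real) \<Rightarrow> bool" where
  "nonincreasing_seq x \<longleftrightarrow> antimono_on {1..} x"

(* Only used with U > 0, in which case an infinite right-hand side makes the inequality trivial. *)
definition hardy_ineq ::
  "real \<Rightarrow> (nat \<Rightarrow> real) \<Rightarrow> (nat \<Rightarrow> real) \<Rightarrow> real \<Rightarrow> bool" where
  "hardy_ineq p b l U \<longleftrightarrow>
    (\<forall>x. nonneg_seq x \<longrightarrow> nonincreasing_seq x \<longrightarrow>
      (\<Sum>\<^sub>\<infinity>n\<in>{1..}. ennreal (b n * (\<Sum>k=1..n. l k * x k / partial_sum l n) powr p))
        \<le> ennreal U * (\<Sum>\<^sub>\<infinity>n\<in>{1..}. ennreal (b n * x n powr p)))"

definition tail_ineq ::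
  "real \<Rightarrow> (nat \<Rightarrow> real) \<Rightarrow> (nat \<Rightarrow> real) \<Rightarrow> real \<Rightarrow> bool" where
  "tail_ineq p b l U \<longleftrightarrow>
    (\<forall>n\<ge>1. (\<Sum>\<^sub>\<infinity>k\<in>{n..}. ennreal (b k / partial_sum l k powr p))
        \<le> ennreal (U / partial_sum l n powr p * (\<Sum>k=1..n. b k)))"

(* Best-possible means the infimum of the admissible positive constants; this is the
   intended value only if some admissible constant exists. *)
definition best_hardy_const :: "real \<Rightarrow> (nat \<Rightarrow> real) \<Rightarrow> (nat \<Rightarrow> real) \<Rightarrow> real" where
  "best_hardy_const p b l = Inf {U. U > 0 \<and> hardy_ineq p b l U}"

definition best_tail_const :: "real \<Rightarrow> (nat \<Rightarrow> real) \<Rightarrow> (nat \<Rightarrow> real) \<Rightarrow> real" where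
  "best_tail_const p b l = Inf {U. U > 0 \<and> tail_ineq p b l U}"

end

theory Submission
  imports Defs
begin

text \<open>
  Write \<open>L n\<close> for the partial sums of the weights, \<open>B n\<close> for those of \<open>b\<close>, and \<open>A n\<close> for the
  weighted mean of \<open>x 1, \<dots>, x n\<close>, so that \<open>A\<close> dominates \<open>x\<close>. Testing inequality (A) on
  the indicator of \<open>{1..n}\<close>, whose mean at \<open>m \<ge> n\<close> is \<open>L n / L m\<close>, yields (B) with the same constant
  (\<open>hardy_imp_tail\<close>). The substance is the converse, with the constant \<open>(p * U' + 1) powr p\<close> for
  every \<open>p \<ge> 1\<close>; for \<open>p > 2\<close> the stated bound then follows from \<open>p * U' + 1 \<le> p * (U' + 1)\<close>.

  It is enough to prove the reverse Hoelder type bound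
  \<open>\<Sum> b A^p \<le> (p U' + 1) \<Sum> b A^(p-1) x\<close>, since Young's inequality with \<open>t = (p U' + 1) x\<close> then
  absorbs the powers of \<open>A\<close> on the right into the left-hand side. For this absorption the sums have to
  be finite, so all estimates are made for sums up to a fixed \<open>N\<close>. Since \<open>A^p = A^(p-1) (A - x) + A^(p-1) x\<close>,
  the bound amounts to \<open>\<Sum> b A^(p-1) (A - x) \<le> p U' \<Sum> b A^(p-1) x\<close>.

  In a continuous model, with \<open>T(t)\<close> the tail integral of \<open>b / L^p\<close>, this is integration by parts,
  and even without the factor \<open>p\<close>. Put \<open>G = L^p A^(p-1) (A - x) = (L A)^(p-1) L (A - x)\<close> and
  \<open>H = A^(p-1) x\<close>. From \<open>d(L A) = x dL\<close> and \<open>d(L (A - x)) = - L dx\<close> one finds \<open>dG = - L^p dH\<close>, so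
  \<open>\<integral> b A^(p-1) (A - x) = \<integral> T dG \<le> U' \<integral> B L^(-p) dG = U' \<integral> B (- dH) \<le> U' \<integral> b H\<close>,
  where the first inequality is (B), used as \<open>T \<le> U' B / L^p\<close>, and the second drops a boundary term.

  In the discrete setting the increment of \<open>G\<close> from \<open>k\<close> to \<open>k + 1\<close> splits into
  \<open>L k ^ p * f k\<close>, where \<open>x\<close> drops, and \<open>L (k+1) ^ p * e k\<close>, where the mean absorbs the new weight.
  The tail from \<open>k + 1\<close> on is estimated by (B) at \<open>k\<close> for the first part and at \<open>k + 1\<close> for the second.
  Then \<open>f k + e k \<le> H k - H (k+1)\<close>, as in the continuous model
  (\<open>powr_secant_le_next_secant\<close>), but \<open>e k\<close> comes with \<open>B (k+1)\<close> in place of \<open>B k\<close>. The excess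
  \<open>e k * b (k+1)\<close> is at most \<open>(p - 1) * H (k+1) * b (k+1)\<close>
  (\<open>powr_secant_le_end_value\<close>), which is how the factor \<open>1 + (p - 1) = p\<close> arises.
\<close>

section \<open>Power inequalities\<close>

text \<open>
  Writing the derivative of the power as \<open>q * (z powr q / z)\<close> lets the exponents below and above
  \<open>1\<close> be treated alike: only the monotonicity of \<open>z powr q\<close> is needed later on.
\<close>

lemma powr_mean_value:
  fixes a b q :: real
  assumes "0 < a" "a \<le> b"
  obtains z where "a \<le> z" "z \<le> b" "b powr q - a powr q = q * (z powr q / z) * (b - a)"
proof (cases "a = b")
  case True
  then show ?thesis using that[of a] by simp
next
  case False
  then have "a < b" using assms by simp
  have "\<exists>z. a < z \<and> z < b \<and> b powr q - a powr q = (b - a) * (q * z powr (q - 1))"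
    using \<open>a < b\<close> assms(1) by (intro MVT2) (auto intro!: has_real_derivative_powr)
  then obtain z where z: "a < z" "z < b" "b powr q - a powr q = (b - a) * (q * z powr (q - 1))"
    by blast
  show ?thesis
    using that[of z] z assms(1) by (simp add: powr_diff mult_ac)
qed

text \<open>
  Here \<open>r\<close> is the ratio \<open>L k / L (k+1)\<close>, \<open>a'\<close> is the mean that follows \<open>a\<close>, and \<open>y\<close> is the new term.
  The two sides are, up to the common factor \<open>(1 - r) * y * (a - y)\<close>, the secant slope of the power
  over \<open>[r * a, a']\<close> times \<open>r\<close>, and the one over \<open>[a', a]\<close>. For \<open>q < 1\<close> slopes decrease from left to right,
  but the two intervals together span only a factor \<open>1 / r\<close>, and this is what the factor \<open>r\<close> pays for.
\<close>

lemma powr_secant_le_next_secant: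
  fixes q r a y a' :: real
  assumes "0 \<le> q" "0 < r" "r \<le> 1" "0 \<le> y" "y \<le> a" and a': "a' = r * a + (1 - r) * y"
  shows "(a' powr q - (r * a) powr q) * (a' - y) \<le> y * (a powr q - a' powr q)"
proof (cases "a = 0")
  case True
  then show ?thesis using assms by simp
next
  case False
  then have a: "0 < a" using assms by simp
  have ra: "0 < r * a" using a assms by simp
  have le1: "r * a \<le> a'" using assms by simp
  have diff: "a - a' = (1 - r) * (a - y)" "a' - r * a = (1 - r) * y" "a' - y = r * (a - y)"
    using a' by (simp_all add: algebra_simps)
  have "0 \<le> (1 - r) * (a - y)" using assms by simp
  then have le2: "a' \<le> a" using diff by linarith
  obtain z where z: "r * a \<le> z" "z \<le> a'"
    "a' powr q - (r * a) powr q = q * (z powr q / z) * (a' - r * a)"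
    using powr_mean_value[OF ra le1] by blast
  have a'pos: "0 < a'" using ra le1 by linarith
  obtain w where w: "a' \<le> w" "w \<le> a" "a powr q - a' powr q = q * (w powr q / w) * (a - a')"
    using powr_mean_value[OF a'pos le2] by blast
  have pos: "0 < z" "0 < w" using z w ra a'pos by linarith+
  have "r * w \<le> r * a" using w assms by simp
  then have rw: "r * w \<le> z" using z by linarith
  have "z powr q \<le> w powr q" using z w pos assms by (intro powr_mono2) auto
  then have "(r * w) * z powr q \<le> z * w powr q" using rw pos assms by (intro mult_mono) auto
  then have "r * (z powr q / z) \<le> w powr q / w" using pos by (simp add: field_simps)
  moreover have "0 \<le> q * (1 - r) * y * (a - y)" using assms by simp
  ultimately have "q * (1 - r) * y * (a - y) * (r * (z powr q / z))
      \<le> q * (1 - r) * y * (a - y) * (w powr q / w)"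
    by (intro mult_left_mono)
  moreover have "(a' powr q - (r * a) powr q) * (a' - y)
      = q * (1 - r) * y * (a - y) * (r * (z powr q / z))"
    unfolding z(3) diff by (simp add: mult_ac)
  moreover have "y * (a powr q - a' powr q) = q * (1 - r) * y * (a - y) * (w powr q / w)"
    unfolding w(3) diff by (simp add: mult_ac)
  ultimately show ?thesis by linarith
qed

text \<open>
  In the setting of the previous lemma, the slope \<open>q * z powr q / z\<close> of the secant is harmless because
  the factor \<open>a' - y = r * (a - y)\<close> does not exceed the left end point \<open>r * a \<le> z\<close>.
\<close>

lemma powr_secant_le_end_value:
  fixes q r a y a' :: real
  assumes "0 \<le> q" "0 < r" "r \<le> 1" "0 \<le> y" "y \<le> a" and a': "a' = r * a + (1 - r) * y"
  shows "(a' powr q - (r * a) powr q) * (a' - y) \<le> q * (a' powr q * y)"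
proof (cases "a = 0")
  case True
  then show ?thesis using assms by simp
next
  case False
  then have a: "0 < a" using assms by simp
  have ra: "0 < r * a" using a assms by simp
  have le1: "r * a \<le> a'" using assms by simp
  have diff: "a' - r * a = (1 - r) * y" "a' - y = r * (a - y)"
    using a' by (simp_all add: algebra_simps)
  obtain z where z: "r * a \<le> z" "z \<le> a'"
    "a' powr q - (r * a) powr q = q * (z powr q / z) * (a' - r * a)"
    using powr_mean_value[OF ra le1] by blast
  have pos: "0 < z" using z ra by linarith
  have "r * (a - y) \<le> r * a" using assms by simp
  then have "r * (a - y) \<le> z" using z by linarith
  moreover have "(1 - r) * (r * (a - y)) \<le> 1 * (r * (a - y))"
    using assms by (intro mult_right_mono) auto
  ultimately have "(1 - r) * (r * (a - y)) \<le> z" by linarith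
  moreover have "z powr q \<le> a' powr q" using z pos assms by (intro powr_mono2) auto
  ultimately have "z powr q * ((1 - r) * (r * (a - y))) \<le> a' powr q * z"
    using pos assms by (intro mult_mono) auto
  then have "z powr q / z * ((1 - r) * (r * (a - y))) \<le> a' powr q"
    using pos by (simp add: field_simps)
  then have "q * y * (z powr q / z * ((1 - r) * (r * (a - y)))) \<le> q * y * a' powr q"
    using assms by (intro mult_left_mono) auto
  moreover have "(a' powr q - (r * a) powr q) * (a' - y)
      = q * y * (z powr q / z * ((1 - r) * (r * (a - y))))"
    unfolding z(3) diff by (simp add: mult_ac)
  ultimately show ?thesis by (simp add: mult_ac)
qed

lemma powr_young:
  fixes p a t :: real
  assumes "1 \<le> p" "0 \<le> a" "0 \<le> t"
  shows "p * (a powr (p - 1) * t) \<le> (p - 1) * a powr p + t powr p"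
proof (cases "a = 0 \<or> t = 0")
  case True
  then show ?thesis using assms by auto
next
  case False
  then have pos: "0 < a" "0 < t" using assms by auto
  have "(a powr p) powr ((p - 1) / p) * (t powr p) powr (1 / p)
      \<le> (p - 1) / p * a powr p + 1 / p * t powr p"
    using assms pos by (intro Youngs_inequality_0) (auto simp: field_simps)
  then have "a powr (p - 1) * t \<le> ((p - 1) * a powr p + t powr p) / p"
    using assms pos by (simp add: powr_powr add_divide_distrib)
  then show ?thesis using assms by (simp add: field_simps)
qed

section \<open>Summation by parts\<close>

lemma sum_mult_eq_sum_increments_mult_tail:
  fixes w G :: "nat \<Rightarrow> real"
  assumes "G 1 = 0"
  shows "(\<Sum>n=1..N. w n * G n) = (\<Sum>k=1..<N. (G (Suc k) - G k) * (\<Sum>j=Suc k..N. w j))"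
proof (induction N)
  case (Suc N)
  show ?case
  proof (cases "N = 0")
    case True
    then show ?thesis using assms by simp
  next
    case False
    then have N: "1 \<le> N" by simp
    have "(\<Sum>k=1..<Suc N. (G (Suc k) - G k) * (\<Sum>j=Suc k..Suc N. w j))
        = (\<Sum>k=1..<Suc N. (G (Suc k) - G k) * (\<Sum>j=Suc k..N. w j) + (G (Suc k) - G k) * w (Suc N))"
      by (intro sum.cong refl) (auto simp: algebra_simps)
    also have "\<dots> = (\<Sum>k=1..<Suc N. (G (Suc k) - G k) * (\<Sum>j=Suc k..N. w j))
        + (\<Sum>k=1..<Suc N. G (Suc k) - G k) * w (Suc N)"
      by (simp add: sum.distrib sum_distrib_right del: sum.op_ivl_Suc)
    also have "(\<Sum>k=1..<Suc N. G (Suc k) - G k) = G (Suc N)"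
      using N assms by (subst sum_Suc_diff') auto
    also have "(\<Sum>k=1..<Suc N. (G (Suc k) - G k) * (\<Sum>j=Suc k..N. w j))
        = (\<Sum>k=1..<N. (G (Suc k) - G k) * (\<Sum>j=Suc k..N. w j))"
      using N by simp
    finally show ?thesis using Suc.IH by (simp add: mult_ac)
  qed
qed simp

lemma sum_decrements_mult_partial_sum:
  fixes b H :: "nat \<Rightarrow> real"
  assumes "1 \<le> N"
  shows "(\<Sum>k=1..<N. (H k - H (Suc k)) * (\<Sum>j=1..k. b j))
    = (\<Sum>k=1..N. b k * H k) - H N * (\<Sum>j=1..N. b j)"
  using assms by (induction N rule: dec_induct) (auto simp: algebra_simps)

section \<open>The inequality for finite sums\<close>

text \<open>
  The means enter only through \<open>A 1 = x 1\<close> and the recurrence for \<open>L n * A n\<close>. The proof is the discrete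
  integration by parts described at the beginning, followed by Young's inequality.
\<close>

lemma hardy_finite_core:
  fixes p V :: real and b L A x :: "nat \<Rightarrow> real"
  assumes p: "1 \<le> p" and V: "0 \<le> V"
    and b: "\<And>n. 1 \<le> n \<Longrightarrow> 0 \<le> b n"
    and L: "\<And>n. 1 \<le> n \<Longrightarrow> 0 < L n" "\<And>n. 1 \<le> n \<Longrightarrow> L n \<le> L (Suc n)"
    and x: "\<And>n. 1 \<le> n \<Longrightarrow> 0 \<le> x n" "\<And>n. 1 \<le> n \<Longrightarrow> x (Suc n) \<le> x n"
    and A1: "A 1 = x 1"
    and AS: "\<And>n. 1 \<le> n \<Longrightarrow> L (Suc n) * A (Suc n) = L n * A n + (L (Suc n) - L n) * x (Suc n)"
    and tail: "\<And>n. 1 \<le> n \<Longrightarrow>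
      (\<Sum>k=n..N. b k / L k powr p) \<le> V / L n powr p * (\<Sum>k=1..n. b k)"
  shows "(\<Sum>n=1..N. b n * A n powr p) \<le> (p * V + 1) powr p * (\<Sum>n=1..N. b n * x n powr p)"
proof (cases "N = 0")
  case True
  then show ?thesis by simp
next
  case False
  then have N: "1 \<le> N" by simp
  define q where "q = p - 1"
  have q: "0 \<le> q" "p = q + 1" using p by (simp_all add: q_def)
  define r where "r n = L n / L (Suc n)" for n
  have r: "0 < r n" "r n \<le> 1" if "1 \<le> n" for n
    using L(1)[of n] L(1)[of "Suc n"] L(2)[of n] that by (auto simp: r_def)
  have Ar: "A (Suc n) = r n * A n + (1 - r n) * x (Suc n)" if "1 \<le> n" for n
    using AS[OF that] L(1)[of "Suc n"] by (simp add: r_def field_simps)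
  have xA: "x n \<le> A n" if "1 \<le> n" for n
    using that
  proof (induction n rule: dec_induct)
    case base
    then show ?case using A1 by simp
  next
    case (step n)
    have "x (Suc n) \<le> A n" using step x(2)[of n] by simp
    then have "r n * x (Suc n) \<le> r n * A n" using r[of n] step by simp
    then show ?case using Ar[of n] step by (simp add: algebra_simps)
  qed
  have A0: "0 \<le> A n" if "1 \<le> n" for n using xA[OF that] x(1)[OF that] by simp
  have powr_p: "a powr p = a powr q * a" if "0 \<le> a" for a :: real
    using that by (cases "a = 0") (auto simp: q powr_add)
  define B where "B n = (\<Sum>k=1..n. b k)" for n
  define T where "T n = (\<Sum>k=n..N. b k / L k powr p)" for n
  define G where "G n = L n powr p * (A n powr q * (A n - x n))" for n
  define H where "H n = A n powr q * x n" for n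
  define f where "f n = A n powr q * (x n - x (Suc n))" for n
  define e where "e n = (A (Suc n) powr q - (r n * A n) powr q) * (A (Suc n) - x (Suc n))" for n
  have B0: "0 \<le> B n" for n unfolding B_def by (intro sum_nonneg) (auto intro: b)
  have H0: "0 \<le> H n" if "1 \<le> n" for n using x(1)[OF that] by (simp add: H_def)
  have f0: "0 \<le> f n" if "1 \<le> n" for n using x(2)[OF that] by (simp add: f_def)
  have e0: "0 \<le> e n" if "1 \<le> n" for n
  proof -
    have "0 \<le> (1 - r n) * x (Suc n)" using r[OF that] x(1)[of "Suc n"] by simp
    then have "r n * A n \<le> A (Suc n)" using Ar[OF that] by linarith
    then have "(r n * A n) powr q \<le> A (Suc n) powr q"
      using r[OF that] A0[OF that] q by (intro powr_mono2) auto
    then show ?thesis using xA[of "Suc n"] by (simp add: e_def)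
  qed
  \<comment> \<open>The factors of \<open>(L A)^q * (L (A - x))\<close> change one at a time: the second factor
    grows by \<open>L k * (x k - x (k+1))\<close>, then the first one is updated. The scaling \<open>r k\<close> expresses
    the old value of \<open>L A\<close> in units of the new \<open>L\<close>.\<close>
  have increment: "G (Suc k) - G k = L k powr p * f k + L (Suc k) powr p * e k" if k: "1 \<le> k" for k
  proof -
    have Lk: "0 < L k" "0 < L (Suc k)" using L(1)[of k] L(1)[of "Suc k"] k by auto
    have "L (Suc k) * (A (Suc k) - x (Suc k)) = L k * (A k - x (Suc k))"
      using AS[OF k] by (simp add: algebra_simps)
    moreover have "L (Suc k) powr q * (r k * A k) powr q = L k powr q * A k powr q"
      using Lk A0[OF k] by (simp add: r_def powr_mult powr_divide)
    ultimately have "(L (Suc k) powr q * (r k * A k) powr q) * (L (Suc k) * (A (Suc k) - x (Suc k)))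
        = (L k powr q * A k powr q) * (L k * (A k - x (Suc k)))"
      by simp
    then have "L (Suc k) powr p * ((r k * A k) powr q * (A (Suc k) - x (Suc k)))
        = L k powr p * (A k powr q * (A k - x (Suc k)))"
      using Lk powr_p[of "L k"] powr_p[of "L (Suc k)"] by (simp add: mult_ac)
    then show ?thesis by (simp add: G_def f_def e_def algebra_simps)
  qed
  have fe: "f k + e k \<le> H k - H (Suc k)" if k: "1 \<le> k" for k
  proof -
    have "e k \<le> x (Suc k) * (A k powr q - A (Suc k) powr q)"
      unfolding e_def using q r[OF k] x(1)[of "Suc k"] x(2)[OF k] xA[OF k] Ar[OF k]
      by (intro powr_secant_le_next_secant[where r = "r k"]) auto
    then show ?thesis by (simp add: f_def H_def algebra_simps)
  qed
  have eH: "e k \<le> q * H (Suc k)" if k: "1 \<le> k" for k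
    using powr_secant_le_end_value[of q "r k" "x (Suc k)" "A k" "A (Suc k)"]
      q r[OF k] x(1)[of "Suc k"] x(2)[OF k] xA[OF k] Ar[OF k]
    by (simp add: e_def H_def)
  have T_le: "L n powr p * T n \<le> V * B n" if "1 \<le> n" for n
    using tail[OF that] L(1)[OF that] by (simp add: T_def B_def field_simps)
  have T_antimono: "T (Suc n) \<le> T n" if "1 \<le> n" for n
    unfolding T_def using that b by (intro sum_mono2) auto
  have main: "(G (Suc k) - G k) * T (Suc k)
      \<le> V * ((H k - H (Suc k)) * B k + q * (b (Suc k) * H (Suc k)))" if k: "1 \<le> k" for k
  proof -
    have "L k powr p * T (Suc k) \<le> L k powr p * T k"
      using T_antimono[OF k] by (intro mult_left_mono) auto
    then have "L k powr p * T (Suc k) \<le> V * B k" using T_le[OF k] by linarith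
    then have 1: "f k * (L k powr p * T (Suc k)) \<le> f k * (V * B k)"
      using f0[OF k] by (intro mult_left_mono)
    have 2: "e k * (L (Suc k) powr p * T (Suc k)) \<le> e k * (V * B (Suc k))"
      using T_le[of "Suc k"] e0[OF k] by (intro mult_left_mono) auto
    have 3: "(f k + e k) * B k \<le> (H k - H (Suc k)) * B k"
      using fe[OF k] B0 by (intro mult_right_mono)
    have 4: "e k * b (Suc k) \<le> q * H (Suc k) * b (Suc k)"
      using eH[OF k] b[of "Suc k"] by (intro mult_right_mono) auto
    have BS: "B (Suc k) = B k + b (Suc k)" by (simp add: B_def)
    have "(G (Suc k) - G k) * T (Suc k)
        = f k * (L k powr p * T (Suc k)) + e k * (L (Suc k) powr p * T (Suc k))"
      unfolding increment[OF k] by (simp add: algebra_simps)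
    also have "\<dots> \<le> V * ((f k + e k) * B k + e k * b (Suc k))"
      using 1 2 by (simp add: BS algebra_simps)
    also have "\<dots> \<le> V * ((H k - H (Suc k)) * B k + q * (b (Suc k) * H (Suc k)))"
      using 3 4 V by (intro mult_left_mono) (auto simp: mult_ac)
    finally show ?thesis .
  qed
  have bH0: "0 \<le> b n * H n" if "1 \<le> n" for n using b H0 that by simp
  have "(\<Sum>n=1..N. b n * (A n powr q * (A n - x n))) = (\<Sum>n=1..N. b n / L n powr p * G n)"
    using L(1) by (intro sum.cong refl) (force simp: G_def)
  also have "\<dots> = (\<Sum>k=1..<N. (G (Suc k) - G k) * T (Suc k))"
    unfolding T_def by (rule sum_mult_eq_sum_increments_mult_tail) (use A1 in \<open>simp add: G_def\<close>)
  also have "\<dots> \<le> (\<Sum>k=1..<N. V * ((H k - H (Suc k)) * B k + q * (b (Suc k) * H (Suc k))))"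
    by (intro sum_mono main) simp
  also have "\<dots> = V * ((\<Sum>k=1..<N. (H k - H (Suc k)) * B k) + q * (\<Sum>k=1..<N. b (Suc k) * H (Suc k)))"
    by (simp add: sum_distrib_left[symmetric] sum.distrib)
  also have "\<dots> \<le> V * ((\<Sum>n=1..N. b n * H n) + q * (\<Sum>n=1..N. b n * H n))"
  proof -
    have "(\<Sum>k=1..<N. (H k - H (Suc k)) * B k) \<le> (\<Sum>n=1..N. b n * H n)"
      unfolding B_def sum_decrements_mult_partial_sum[OF N]
      using H0[OF N] B0[of N] by (simp add: B_def)
    moreover have "(\<Sum>k=1..<N. b (Suc k) * H (Suc k)) = (\<Sum>n=Suc 1..<Suc N. b n * H n)"
      by (subst sum.shift_bounds_Suc_ivl) simp
    moreover have "(\<Sum>n=Suc 1..<Suc N. b n * H n) \<le> (\<Sum>n=1..N. b n * H n)"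
      by (intro sum_mono2) (auto intro: bH0)
    ultimately show ?thesis using V q by (intro mult_left_mono add_mono) auto
  qed
  also have "\<dots> = p * V * (\<Sum>n=1..N. b n * H n)" by (simp add: q algebra_simps)
  finally have "(\<Sum>n=1..N. b n * (A n powr q * (A n - x n))) \<le> p * V * (\<Sum>n=1..N. b n * H n)" .
  moreover have "(\<Sum>n=1..N. b n * A n powr p)
      = (\<Sum>n=1..N. b n * (A n powr q * (A n - x n))) + (\<Sum>n=1..N. b n * H n)"
    unfolding sum.distrib[symmetric] using A0
    by (intro sum.cong refl) (simp add: powr_p H_def algebra_simps)
  ultimately have reverse: "(\<Sum>n=1..N. b n * A n powr p) \<le> (p * V + 1) * (\<Sum>n=1..N. b n * H n)"
    by (simp add: algebra_simps)
  \<comment> \<open>Young's inequality turns the mixed sum into \<open>p - 1\<close> copies of the left-hand side, which cancel.\<close>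
  define C where "C = p * V + 1"
  have C: "0 \<le> C" using p V by (simp add: C_def)
  have "p * (\<Sum>n=1..N. b n * A n powr p) \<le> p * (C * (\<Sum>n=1..N. b n * H n))"
    using reverse p by (intro mult_left_mono) (auto simp: C_def)
  also have "\<dots> = (\<Sum>n=1..N. b n * (p * (A n powr (p - 1) * (C * x n))))"
    by (simp add: H_def q_def sum_distrib_left mult_ac)
  also have "\<dots> \<le> (\<Sum>n=1..N. b n * ((p - 1) * A n powr p + (C * x n) powr p))"
    using A0 x(1) C p b by (intro sum_mono mult_left_mono powr_young) auto
  also have "\<dots> = (\<Sum>n=1..N. (p - 1) * (b n * A n powr p) + C powr p * (b n * x n powr p))"
    using C x(1) by (intro sum.cong refl) (simp add: powr_mult algebra_simps)
  also have "\<dots> = (p - 1) * (\<Sum>n=1..N. b n * A n powr p) + C powr p * (\<Sum>n=1..N. b n * x n powr p)"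
    by (simp add: sum.distrib sum_distrib_left)
  finally show ?thesis by (simp add: C_def algebra_simps)
qed

section \<open>Passage to infinite sums\<close>

lemma infsum_ennreal_atLeast_le_iff:
  fixes f :: "nat \<Rightarrow> real"
  assumes f: "\<And>k. n \<le> k \<Longrightarrow> 0 \<le> f k"
  shows "(\<Sum>\<^sub>\<infinity>k\<in>{n..}. ennreal (f k)) \<le> C \<longleftrightarrow> (\<forall>N. ennreal (\<Sum>k=n..N. f k) \<le> C)"
proof
  assume *: "(\<Sum>\<^sub>\<infinity>k\<in>{n..}. ennreal (f k)) \<le> C"
  show "\<forall>N. ennreal (\<Sum>k=n..N. f k) \<le> C"
  proof
    fix N
    have "ennreal (\<Sum>k=n..N. f k) = (\<Sum>k=n..N. ennreal (f k))"
      using f by (intro sum_ennreal[symmetric]) auto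
    also have "\<dots> \<le> (\<Sum>\<^sub>\<infinity>k\<in>{n..}. ennreal (f k))"
      by (subst nonneg_infsum_complete) (simp, rule SUP_upper, simp)
    also note *
    finally show "ennreal (\<Sum>k=n..N. f k) \<le> C" .
  qed
next
  assume *: "\<forall>N. ennreal (\<Sum>k=n..N. f k) \<le> C"
  show "(\<Sum>\<^sub>\<infinity>k\<in>{n..}. ennreal (f k)) \<le> C"
  proof (rule infsum_le_finite_sums)
    show "(\<lambda>k. ennreal (f k)) summable_on {n..}"
      by (intro nonneg_summable_on_complete) auto
    fix F :: "nat set"
    assume F: "finite F" "F \<subseteq> {n..}"
    then obtain N where N: "F \<subseteq> {n..N}"
      using finite_nat_set_iff_bounded_le[of F] by (metis atLeast_iff atLeastAtMost_iff subset_eq)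
    have "(\<Sum>k\<in>F. ennreal (f k)) \<le> (\<Sum>k=n..N. ennreal (f k))"
      using N by (intro sum_mono2) auto
    also have "\<dots> = ennreal (\<Sum>k=n..N. f k)" using f by (intro sum_ennreal) auto
    also have "\<dots> \<le> C" using * by blast
    finally show "(\<Sum>k\<in>F. ennreal (f k)) \<le> C" .
  qed
qed

lemma partial_sum_pos:
  assumes "nonneg_seq l" "l 1 > 0" "1 \<le> n"
  shows "0 < partial_sum l n"
proof -
  have "l 1 \<le> (\<Sum>k=1..n. l k)"
    using assms by (intro member_le_sum) (auto simp: nonneg_seq_def)
  then show ?thesis using assms by (simp add: partial_sum_def)
qed

lemma tail_ineq_iff_finite:
  assumes b: "nonneg_seq b" and l: "nonneg_seq l" "l 1 > 0" and U: "0 \<le> U"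
  shows "tail_ineq p b l U \<longleftrightarrow> (\<forall>n\<ge>1. \<forall>N.
    (\<Sum>k=n..N. b k / partial_sum l k powr p) \<le> U / partial_sum l n powr p * (\<Sum>k=1..n. b k))"
proof -
  have rhs: "0 \<le> U / partial_sum l n powr p * (\<Sum>k=1..n. b k)" for n
    using b U by (intro mult_nonneg_nonneg sum_nonneg) (auto simp: nonneg_seq_def)
  have "(\<Sum>\<^sub>\<infinity>k\<in>{n..}. ennreal (b k / partial_sum l k powr p))
        \<le> ennreal (U / partial_sum l n powr p * (\<Sum>k=1..n. b k)) \<longleftrightarrow>
      (\<forall>N. (\<Sum>k=n..N. b k / partial_sum l k powr p) \<le> U / partial_sum l n powr p * (\<Sum>k=1..n. b k))"
    if "1 \<le> n" for n
    using b that rhs by (subst infsum_ennreal_atLeast_le_iff) (auto simp: nonneg_seq_def)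
  then show ?thesis unfolding tail_ineq_def by blast
qed

section \<open>The two inequalities and their best constants\<close>

text \<open>
  The indicator of \<open>{1..n}\<close> makes the right-hand side of (A) a multiple of \<open>b 1 + \<dots> + b n\<close>,
  while the terms \<open>m \<ge> n\<close> on the left are exactly \<open>L n powr p\<close> times those of the tail.
\<close>

lemma hardy_imp_tail:
  assumes b: "nonneg_seq b" and l: "nonneg_seq l" "l 1 > 0" and U: "0 < U"
    and hardy: "hardy_ineq p b l U"
  shows "tail_ineq p b l U"
  unfolding tail_ineq_iff_finite[OF b l less_imp_le[OF U]]
proof (intro allI impI)
  fix n N :: nat
  assume n: "1 \<le> n"
  define L where "L = partial_sum l"
  have L: "0 < L k" if "1 \<le> k" for k using partial_sum_pos[OF l that] by (simp add: L_def)
  define x :: "nat \<Rightarrow> real" where "x k = (if k \<le> n then 1 else 0)" for k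
  have mean: "(\<Sum>k=1..m. l k * x k / L m) = L n / L m" if "n \<le> m" for m
  proof -
    have "(\<Sum>k=1..m. l k * x k / L m) = (\<Sum>k=1..n. l k / L m)"
      using that by (intro sum.mono_neutral_cong_right) (auto simp: x_def)
    then show ?thesis by (simp add: L_def partial_sum_def sum_divide_distrib)
  qed
  have terms: "0 \<le> b k * (\<Sum>j=1..k. l j * x j / L k) powr p" if "1 \<le> k" for k
    using b that by (simp add: nonneg_seq_def)
  have "(\<Sum>\<^sub>\<infinity>m\<in>{1..}. ennreal (b m * x m powr p)) = (\<Sum>\<^sub>\<infinity>m\<in>{1..n}. ennreal (b m))"
    by (intro infsum_cong_neutral) (auto simp: x_def)
  also have "\<dots> = ennreal (\<Sum>m=1..n. b m)"
    using b by (subst infsum_finite) (simp, rule sum_ennreal, simp add: nonneg_seq_def)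
  finally have rhs: "(\<Sum>\<^sub>\<infinity>m\<in>{1..}. ennreal (b m * x m powr p)) = ennreal (\<Sum>m=1..n. b m)" .
  have "nonneg_seq x" "nonincreasing_seq x"
    by (auto simp: nonneg_seq_def nonincreasing_seq_def monotone_on_def x_def)
  then have "(\<Sum>\<^sub>\<infinity>m\<in>{1..}. ennreal (b m * (\<Sum>k=1..m. l k * x k / L m) powr p))
      \<le> ennreal U * (\<Sum>\<^sub>\<infinity>m\<in>{1..}. ennreal (b m * x m powr p))"
    unfolding L_def by (rule hardy[unfolded hardy_ineq_def, rule_format])
  then have "(\<Sum>\<^sub>\<infinity>m\<in>{1..}. ennreal (b m * (\<Sum>k=1..m. l k * x k / L m) powr p))
      \<le> ennreal U * ennreal (\<Sum>m=1..n. b m)"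
    unfolding rhs .
  then have "ennreal (\<Sum>m=1..N. b m * (\<Sum>k=1..m. l k * x k / L m) powr p)
      \<le> ennreal (U * (\<Sum>m=1..n. b m))"
    using U terms by (subst (asm) infsum_ennreal_atLeast_le_iff) (auto simp: ennreal_mult')
  moreover have "0 \<le> (\<Sum>m=1..n. b m)" using b by (intro sum_nonneg) (auto simp: nonneg_seq_def)
  ultimately have le: "(\<Sum>m=1..N. b m * (\<Sum>k=1..m. l k * x k / L m) powr p)
      \<le> U * (\<Sum>m=1..n. b m)"
    using U by (subst (asm) ennreal_le_iff) auto
  have "L n powr p * (\<Sum>m=n..N. b m / L m powr p)
      = (\<Sum>m=n..N. b m * (\<Sum>k=1..m. l k * x k / L m) powr p)"
    unfolding sum_distrib_left
    using n L[of n] by (intro sum.cong refl, subst mean) (auto simp: powr_divide less_imp_le[OF L])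
  also have "\<dots> \<le> (\<Sum>m=1..N. b m * (\<Sum>k=1..m. l k * x k / L m) powr p)"
    using n terms by (intro sum_mono2) auto
  also note le
  finally show "(\<Sum>k=n..N. b k / partial_sum l k powr p)
      \<le> U / partial_sum l n powr p * (\<Sum>k=1..n. b k)"
    using L[OF n] unfolding L_def by (simp add: field_simps)
qed

lemma tail_imp_hardy:
  assumes p: "1 \<le> p" and b: "nonneg_seq b" and l: "nonneg_seq l" "l 1 > 0" and U: "0 < U"
    and tail: "tail_ineq p b l U"
  shows "hardy_ineq p b l ((p * U + 1) powr p)"
  unfolding hardy_ineq_def
proof (intro allI impI)
  fix x :: "nat \<Rightarrow> real"
  assume x: "nonneg_seq x" "nonincreasing_seq x"
  define L where "L = partial_sum l"
  have L: "0 < L k" if "1 \<le> k" for k using partial_sum_pos[OF l that] by (simp add: L_def)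
  define A where "A n = (\<Sum>k=1..n. l k * x k / L n)" for n
  define C where "C = (p * U + 1) powr p"
  have LA: "L n * A n = (\<Sum>k=1..n. l k * x k)" if "1 \<le> n" for n
    using L[OF that] by (simp add: A_def sum_distrib_left)
  have LS: "L (Suc n) = L n + l (Suc n)" for n by (simp add: L_def partial_sum_def)
  have finite: "(\<Sum>n=1..N. b n * A n powr p) \<le> C * (\<Sum>n=1..N. b n * x n powr p)" for N
    unfolding C_def
  proof (rule hardy_finite_core[where L = L])
    show "(\<Sum>k=n..N. b k / L k powr p) \<le> U / L n powr p * (\<Sum>k=1..n. b k)" if "1 \<le> n" for n
      using tail that unfolding tail_ineq_iff_finite[OF b l less_imp_le[OF U]] L_def by blast
    show "A 1 = x 1" using l by (simp add: A_def L_def partial_sum_def)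
    show "L (Suc n) * A (Suc n) = L n * A n + (L (Suc n) - L n) * x (Suc n)" if "1 \<le> n" for n
      using LA[of n] LA[of "Suc n"] LS that by simp
    show "x (Suc n) \<le> x n" if "1 \<le> n" for n
      using x(2) that by (auto simp: nonincreasing_seq_def monotone_on_def)
    show "L n \<le> L (Suc n)" for n
      using l by (simp add: LS nonneg_seq_def)
  qed (use p U b x L in \<open>auto simp: nonneg_seq_def\<close>)
  have "ennreal (\<Sum>n=1..N. b n * A n powr p)
      \<le> ennreal C * (\<Sum>\<^sub>\<infinity>n\<in>{1..}. ennreal (b n * x n powr p))" for N
  proof -
    have bx: "0 \<le> b n * x n powr p" if "1 \<le> n" for n
      using b that by (simp add: nonneg_seq_def)
    have "ennreal (\<Sum>n=1..N. b n * A n powr p) \<le> ennreal (C * (\<Sum>n=1..N. b n * x n powr p))"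
      using finite by (intro ennreal_leI)
    also have "\<dots> = ennreal C * ennreal (\<Sum>n=1..N. b n * x n powr p)"
      by (simp add: C_def ennreal_mult')
    also have "ennreal (\<Sum>n=1..N. b n * x n powr p) \<le> (\<Sum>\<^sub>\<infinity>n\<in>{1..}. ennreal (b n * x n powr p))"
      using infsum_ennreal_atLeast_le_iff[of 1 "\<lambda>n. b n * x n powr p"] bx by blast
    finally show ?thesis by (simp add: mult_left_mono)
  qed
  then have "(\<Sum>\<^sub>\<infinity>n\<in>{1..}. ennreal (b n * A n powr p))
      \<le> ennreal C * (\<Sum>\<^sub>\<infinity>n\<in>{1..}. ennreal (b n * x n powr p))"
    using b by (subst infsum_ennreal_atLeast_le_iff) (auto simp: nonneg_seq_def)
  then show "(\<Sum>\<^sub>\<infinity>n\<in>{1..}. ennreal (b n * (\<Sum>k=1..n. l k * x k / partial_sum l n) powr p))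
      \<le> ennreal ((p * U + 1) powr p) * (\<Sum>\<^sub>\<infinity>n\<in>{1..}. ennreal (b n * x n powr p))"
    by (simp add: A_def L_def C_def)
qed

theorem theorem1p1:
  fixes p :: real and b l :: "nat \<Rightarrow> real"
  assumes "p \<ge> 1"
    and "nonneg_seq b"
    and "nonneg_seq l" and "nonincreasing_seq l" and "l 1 > 0"
  shows "((\<exists>U>0. hardy_ineq p b l U) \<longleftrightarrow> (\<exists>U'>0. tail_ineq p b l U')) \<and>
    ((\<exists>U>0. hardy_ineq p b l U) \<longrightarrow>
      best_tail_const p b l \<le> best_hardy_const p b l \<and>
      best_hardy_const p b l \<le>
        (if p \<le> 2 then (p * best_tail_const p b l + 1) powr p
         else p powr p * (best_tail_const p b l + 1) powr p))"
proof -
  define HS where "HS = {U. U > 0 \<and> hardy_ineq p b l U}"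
  define TS where "TS = {U. U > 0 \<and> tail_ineq p b l U}"
  define h where "h = best_hardy_const p b l"
  define t where "t = best_tail_const p b l"
  have h: "h = Inf HS" and t: "t = Inf TS"
    by (simp_all add: h_def t_def best_hardy_const_def best_tail_const_def HS_def TS_def)
  have sub: "HS \<subseteq> TS" using assms hardy_imp_tail by (auto simp: HS_def TS_def)
  have into_HS: "(p * U + 1) powr p \<in> HS" if "U \<in> TS" for U
  proof -
    have "0 < p * U + 1" using that assms(1) by (simp add: TS_def add_pos_pos)
    then show ?thesis using that assms tail_imp_hardy by (simp add: HS_def TS_def)
  qed
  have "HS \<noteq> {} \<longleftrightarrow> TS \<noteq> {}" using sub into_HS by auto
  then have equiv: "(\<exists>U>0. hardy_ineq p b l U) \<longleftrightarrow> (\<exists>U'>0. tail_ineq p b l U')"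
    by (simp add: HS_def TS_def)
  have bounds: "t \<le> h \<and> h \<le> (if p \<le> 2 then (p * t + 1) powr p else p powr p * (t + 1) powr p)"
    if ex: "\<exists>U>0. hardy_ineq p b l U"
  proof -
    have ne: "HS \<noteq> {}" "TS \<noteq> {}" using ex sub by (auto simp: HS_def)
    have bdd: "bdd_below HS" "bdd_below TS"
      by (auto simp: HS_def TS_def bdd_below_def intro!: exI[of _ 0])
    have t0: "0 \<le> t" unfolding t using ne by (intro cInf_greatest) (auto simp: TS_def)
    have h0: "0 \<le> h" unfolding h using ne by (intro cInf_greatest) (auto simp: HS_def)
    have th: "t \<le> h" unfolding t h using ne bdd sub by (intro cInf_superset_mono)
    \<comment> \<open>Solving \<open>h \<le> (p * U + 1) powr p\<close> for \<open>U\<close> lets the infimum over \<open>U\<close> be taken without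
      asking whether it is attained.\<close>
    have "(h powr (1 / p) - 1) / p \<le> t"
      unfolding t
    proof (rule cInf_greatest[OF ne(2)])
      fix U assume U: "U \<in> TS"
      have "h \<le> (p * U + 1) powr p" unfolding h by (intro cInf_lower into_HS U bdd)
      then have "h powr (1 / p) \<le> ((p * U + 1) powr p) powr (1 / p)"
        using h0 assms(1) by (intro powr_mono2) auto
      also have "\<dots> = p * U + 1"
        using assms(1) U by (simp add: powr_powr TS_def)
      finally show "(h powr (1 / p) - 1) / p \<le> U" using assms(1) by (simp add: field_simps)
    qed
    then have "h powr (1 / p) \<le> p * t + 1" using assms(1) by (simp add: field_simps)
    then have "(h powr (1 / p)) powr p \<le> (p * t + 1) powr p"
      using assms(1) by (intro powr_mono2) auto
    then have main: "h \<le> (p * t + 1) powr p" using h0 assms(1) by (simp add: powr_powr)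
    also have "\<dots> \<le> (p * (t + 1)) powr p"
      using t0 assms(1) by (intro powr_mono2) (auto simp: algebra_simps)
    also have "\<dots> = p powr p * (t + 1) powr p" using t0 assms(1) by (simp add: powr_mult)
    finally show ?thesis using th main by simp
  qed
  show ?thesis by (rule conjI[OF equiv impI]) (rule bounds[unfolded h_def t_def])
qed

end
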